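(* For the regular hexagon with side length $\ell$, the mixing time of the Luby-Randall-Sinclair lozenge tiling Markov chain is at least $\left(\frac{8}{\pi^2}-o(1)\right)\ell^4\log\ell$ as $\ell\to\infty$.
   Context: Consider the triangular lattice of unit equilateral triangles with one family of edges vertical, and the regular hexagon with side length $\ell$ (two of its sides vertical). A lozenge is a union of two triangles sharing an edge. In the lattice path representation, lozenge tilings of the hexagon correspond bijectively to families of $\ell$ nonintersecting (vertex-disjoint) lattice paths, each having $2\ell$ steps moving by $1$ horizontally and $\pm\frac12$ vertically ($\ell$ steps up and $\ell$ steps down), with the $\ell$ paths starting at $\ell$ vertically consecutive points (spaced by 1) on the left side and ending at the corresponding $\ell$ points on the right side. Write $h_i(x)$ for the height of path $i$ at horizontal coordinate $x$. Luby-Randall-Sinclair chain: at each step choose uniformly one of the internal (non-endpoint) points on the paths, say on path $i$ at coordinate $x$, and choose up or down with probability $1/2$ each. If the direction is up and path $i$ has a local minimum at $x$ ($h_i(x\pm1)=h_i(x)+\frac12$), let $k\ge0$ be the smallest integer such that the point at coordinate $x$ and height $h_i(x)+k+1$ is not on any path (so $k$ paths block the move); with probability $1/(k+1)$ the heights at $x$ of path $i$ and of the $k$ blocking paths above it are all raised by 1, and otherwise nothing changes. Pushing down a local maximum is defined symmetrically. In all other cases nothing changes. The stationary distribution is uniform. The mixing time is the least $t$ for which $\bar d(t)<1/e$, where $\bar d(t)=\max_{x,y}\|P_x^t-P_y^t\|_{TV}$, $P_x^t$ is the law at time $t$ of the chain started from $x$, and $\|\cdot\|_{TV}=\frac12\|\cdot\|_1$.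 $\log$ is the natural logarithm. *)

theory Defs
  imports "HOL-Probability.Probability" "HOL-Library.Landau_Symbols"
begin

type_synonym path_family = "nat \<Rightarrow> nat \<Rightarrow> real"

text \<open>
  A lozenge tiling of the regular hexagon of side \<open>l\<close>, as \<open>l\<close> nonintersecting lattice paths
  of \<open>2 * l\<close> steps: \<open>h i x\<close> is the height of path \<open>i\<close> at horizontal coordinate \<open>x\<close>. The vertical
  origin is the lowest starting point, and paths are numbered from bottom to top starting at 0.
  Equal start and end heights force \<open>l\<close> up-steps and \<open>l\<close> down-steps. The value 0 outside the
  index range only makes the representing function unique, so that there are finitely many tilings.
\<close>

definition tilings :: "nat \<Rightarrow> path_family set" where
  "tilings l = {h.
     (\<forall>i<l. h i 0 = real i \<and> h i (2 * l) = real i) \<and>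
     (\<forall>i<l. \<forall>x<2 * l. h i (x + 1) = h i x + 1/2 \<or> h i (x + 1) = h i x - 1/2) \<and>
     (\<forall>i<l. \<forall>j<l. \<forall>x\<le>2 * l. i \<noteq> j \<longrightarrow> h i x \<noteq> h j x) \<and>
     (\<forall>i x. \<not> (i < l \<and> x \<le> 2 * l) \<longrightarrow> h i x = 0)}"

definition internal_points :: "nat \<Rightarrow> (nat \<times> nat) set" where
  "internal_points l = {0..<l} \<times> {1..2 * l - 1}"

definition local_min :: "path_family \<Rightarrow> nat \<Rightarrow> nat \<Rightarrow> bool" where
  "local_min h i x \<longleftrightarrow> h i (x - 1) = h i x + 1/2 \<and> h i (x + 1) = h i x + 1/2"

definition local_max :: "path_family \<Rightarrow> nat \<Rightarrow> nat \<Rightarrow> bool" where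
  "local_max h i x \<longleftrightarrow> h i (x - 1) = h i x - 1/2 \<and> h i (x + 1) = h i x - 1/2"

definition blockers_up :: "nat \<Rightarrow> path_family \<Rightarrow> nat \<Rightarrow> nat \<Rightarrow> nat" where
  "blockers_up l h i x = (LEAST k. \<forall>j<l. h j x \<noteq> h i x + real k + 1)"

definition blockers_down :: "nat \<Rightarrow> path_family \<Rightarrow> nat \<Rightarrow> nat \<Rightarrow> nat" where
  "blockers_down l h i x = (LEAST k. \<forall>j<l. h j x \<noteq> h i x - real k - 1)"

text \<open>
  Path \<open>i\<close> and its \<open>k\<close> blocking paths are those whose height at \<open>x\<close> lies between \<open>h i x\<close> and
  \<open>h i x + k\<close> (for a push up) or between \<open>h i x - k\<close> and \<open>h i x\<close> (for a push down).
\<close>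

definition push_up :: "nat \<Rightarrow> path_family \<Rightarrow> nat \<Rightarrow> nat \<Rightarrow> path_family" where
  "push_up l h i x = (\<lambda>j y.
     if y = x \<and> j < l \<and> h i x \<le> h j x \<and> h j x \<le> h i x + real (blockers_up l h i x)
     then h j y + 1 else h j y)"

definition push_down :: "nat \<Rightarrow> path_family \<Rightarrow> nat \<Rightarrow> nat \<Rightarrow> path_family" where
  "push_down l h i x = (\<lambda>j y.
     if y = x \<and> j < l \<and> h i x - real (blockers_down l h i x) \<le> h j x \<and> h j x \<le> h i x
     then h j y - 1 else h j y)"

definition lrs_step :: "nat \<Rightarrow> path_family \<Rightarrow> path_family pmf" where
  "lrs_step l h =
     bind_pmf (pmf_of_set (internal_points l)) (\<lambda>(i, x).
     bind_pmf (bernoulli_pmf (1/2)) (\<lambda>up.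
       if up \<and> local_min h i x then
         map_pmf (\<lambda>accept. if accept then push_up l h i x else h)
           (bernoulli_pmf (1 / (real (blockers_up l h i x) + 1)))
       else if \<not> up \<and> local_max h i x then
         map_pmf (\<lambda>accept. if accept then push_down l h i x else h)
           (bernoulli_pmf (1 / (real (blockers_down l h i x) + 1)))
       else return_pmf h))"

primrec lrs_law :: "nat \<Rightarrow> path_family \<Rightarrow> nat \<Rightarrow> path_family pmf" where
  "lrs_law l h 0 = return_pmf h"
| "lrs_law l h (Suc t) = bind_pmf (lrs_law l h t) (lrs_step l)"

definition tv_dist :: "'a pmf \<Rightarrow> 'a pmf \<Rightarrow> real" where
  "tv_dist p q = 1/2 * (\<Sum>\<^sub>\<infinity>z. \<bar>pmf p z - pmf q z\<bar>)"

definition dbar :: "nat \<Rightarrow> nat \<Rightarrow> real" where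
  "dbar l t = Max {tv_dist (lrs_law l g t) (lrs_law l h t) | g h. g \<in> tilings l \<and> h \<in> tilings l}"

definition mixing_time :: "nat \<Rightarrow> nat" where
  "mixing_time l = (LEAST t. dbar l t < 1 / exp 1)"

end

theory Submission
  imports Defs "HOL-Real_Asymp.Real_Asymp"
begin

text \<open>
  Weight the total height displacement at coordinate \<open>x\<close> by \<open>sin (pi x / 2l)\<close>. A push of \<open>k + 1\<close> paths
  is accepted with probability \<open>1 / (k + 1)\<close>, so the expected displacement at \<open>x\<close> moves by a discrete
  Laplacian, and the weighted sum \<open>Phi\<close> is an eigenfunction of the chain with eigenvalue
  \<open>1 - gap l\<close>, where \<open>gap l\<close> is asymptotic to \<open>pi\<^sup>2 / (16 l\<^sup>4)\<close>. One step changes \<open>Phi\<close> by at most \<open>l\<close>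
  in mean square, hence its variance never exceeds \<open>l / (2 gap l)\<close>, of order \<open>l\<^sup>5\<close>. Started from the highest
  and from the lowest tiling, \<open>Phi\<close> has opposite means of initial order \<open>l\<^sup>3\<close>. The two laws stay
  distinguishable as long as the means exceed the standard deviation, that is for about
  \<open>(3 - 5/2) ln l / gap l\<close> steps.

  Since the mixing time is defined by \<open>LEAST\<close>, one also has to know that the chain mixes at all: every
  tiling can be pushed up to the highest one, and Doeblin's argument applies.
\<close>

section \<open>Pushes of lattice paths\<close>

text \<open>The sign \<open>s\<close> merges the two directions: \<open>s = 1\<close> is a local
  minimum to be pushed up, \<open>s = -1\<close> a local maximum to be pushed down. Each fact about
  pushes is then proved once.\<close>

definition loc_ext :: "real \<Rightarrow> path_family \<Rightarrow> nat \<Rightarrow> nat \<Rightarrow> bool" where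
  "loc_ext s h i x \<longleftrightarrow> h i (x - 1) = h i x + s/2 \<and> h i (x + 1) = h i x + s/2"

definition blockers :: "real \<Rightarrow> nat \<Rightarrow> path_family \<Rightarrow> nat \<Rightarrow> nat \<Rightarrow> nat" where
  "blockers s l h i x = (LEAST k. \<forall>j<l. h j x \<noteq> h i x + s * (real k + 1))"

definition moved :: "real \<Rightarrow> nat \<Rightarrow> path_family \<Rightarrow> nat \<Rightarrow> nat \<Rightarrow> nat set" where
  "moved s l h i x = {j. j < l \<and> 0 \<le> s * (h j x - h i x) \<and>
     s * (h j x - h i x) \<le> real (blockers s l h i x)}"

definition push :: "real \<Rightarrow> nat \<Rightarrow> path_family \<Rightarrow> nat \<Rightarrow> nat \<Rightarrow> path_family" where
  "push s l h i x = (\<lambda>j y. if y = x \<and> j \<in> moved s l h i x then h j y + s else h j y)"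

lemma local_min_eq: "local_min h i x = loc_ext 1 h i x"
  by (simp add: local_min_def loc_ext_def)

lemma local_max_eq: "local_max h i x = loc_ext (-1) h i x"
  by (simp add: local_max_def loc_ext_def)

lemma blockers_up_eq: "blockers_up l h i x = blockers 1 l h i x"
  by (simp add: blockers_up_def blockers_def algebra_simps)

lemma blockers_down_eq: "blockers_down l h i x = blockers (-1) l h i x"
  by (simp add: blockers_down_def blockers_def algebra_simps)

lemma push_up_eq: "push_up l h i x = push 1 l h i x"
  unfolding push_up_def push_def moved_def blockers_up_eq
  by (intro ext) (auto simp: algebra_simps)

lemma push_down_eq: "push_down l h i x = push (-1) l h i x"
  unfolding push_down_def push_def moved_def blockers_down_eq
  by (intro ext) (auto simp: algebra_simps)

section \<open>Heights of paths and finiteness of the set of tilings\<close>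

lemma tilings_start: "h \<in> tilings l \<Longrightarrow> i < l \<Longrightarrow> h i 0 = real i"
  and tilings_end: "h \<in> tilings l \<Longrightarrow> i < l \<Longrightarrow> h i (2 * l) = real i"
  and tilings_step: "h \<in> tilings l \<Longrightarrow> i < l \<Longrightarrow> x < 2 * l \<Longrightarrow>
    h i (Suc x) = h i x + 1/2 \<or> h i (Suc x) = h i x - 1/2"
  and tilings_inj: "h \<in> tilings l \<Longrightarrow> i < l \<Longrightarrow> j < l \<Longrightarrow> x \<le> 2 * l \<Longrightarrow> i \<noteq> j \<Longrightarrow> h i x \<noteq> h j x"
  and tilings_outside: "h \<in> tilings l \<Longrightarrow> \<not> (i < l \<and> x \<le> 2 * l) \<Longrightarrow> h i x = 0"
  unfolding tilings_def by (auto simp: Suc_eq_plus1 simp del: One_nat_def)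

text \<open>Differences start as integers, and simultaneous half-steps of two paths change them by
  -1, 0 or 1. Integrality makes blocking paths sit exactly at unit spacing.\<close>

lemma tilings_diff_Ints:
  assumes "h \<in> tilings l" "i < l" "j < l" "x \<le> 2 * l"
  shows "h j x - h i x \<in> \<int>"
  using assms(4)
proof (induction x)
  case 0
  then show ?case using assms by (simp add: tilings_start)
next
  case (Suc x)
  then have I: "h j x - h i x \<in> \<int>" and x: "x < 2 * l" by auto
  have "h j (Suc x) - h i (Suc x) - (h j x - h i x) \<in> {-1, 0, 1}"
    using tilings_step[OF assms(1,2) x] tilings_step[OF assms(1,3) x] by auto
  then have "h j (Suc x) - h i (Suc x) - (h j x - h i x) \<in> \<int>" by auto
  from Ints_add[OF this I] show ?case by simp
qed

text \<open>The same slope bound is read once from the left end and once from the right end.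
  Together the two bounds say that no tiling exceeds the tent-shaped one.\<close>

lemma tilings_bounds:
  assumes "h \<in> tilings l" "i < l" "x \<le> 2 * l"
  shows "\<bar>h i x - real i\<bar> \<le> real x / 2" "\<bar>h i x - real i\<bar> \<le> real (2 * l - x) / 2"
proof -
  show "\<bar>h i x - real i\<bar> \<le> real x / 2"
    using assms(3)
  proof (induction x)
    case (Suc x)
    then have I: "\<bar>h i x - real i\<bar> \<le> real x / 2" and x: "x < 2 * l" by auto
    show ?case using tilings_step[OF assms(1,2) x] I
      unfolding of_nat_Suc abs_le_iff by (elim disjE) simp_all
  qed (simp add: tilings_start[OF assms(1,2)])
  show "\<bar>h i x - real i\<bar> \<le> real (2 * l - x) / 2"
    using assms(3)
  proof (induction x rule: inc_induct)
    case (step x)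
    then have "real (2 * l - x) = real (2 * l - Suc x) + 1" by auto
    then show ?case using tilings_step[OF assms(1,2) step(2)] step(3) by linarith
  qed (simp add: tilings_end[OF assms(1,2)])
qed

lemma finite_tilings: "finite (tilings l)"
proof -
  \<comment> \<open>Heights are half-integers, and they lie between \<open>-l\<close> and
    \<open>2 * l\<close> because a path starts in \<open>[0, l)\<close> and deviates by at most
    \<open>x / 2 \<le> l\<close>.\<close>
  define S where "S = (\<lambda>k. real_of_int k / 2) ` {- 2 * int l..4 * int l}"
  define B :: "(nat \<Rightarrow> real) set"
    where "B = {f. \<forall>x. (x \<in> {..2 * l} \<longrightarrow> f x \<in> S) \<and> (x \<notin> {..2 * l} \<longrightarrow> f x = 0)}"
  have "finite B"
    unfolding B_def by (rule finite_set_of_finite_funs) (auto simp: S_def)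
  then have fin: "finite {h. \<forall>i. (i \<in> {..<l} \<longrightarrow> h i \<in> B) \<and> (i \<notin> {..<l} \<longrightarrow> h i = (\<lambda>_. 0))}"
    by (intro finite_set_of_finite_funs) auto
  have half: "2 * h i x \<in> \<int>" if "h \<in> tilings l" "i < l" "x \<le> 2 * l" for h i x
    using that(3)
  proof (induction x)
    case (Suc x)
    then have I: "2 * h i x \<in> \<int>" and x: "x < 2 * l" by auto
    then have "2 * h i (Suc x) - 2 * h i x \<in> {-1, 1}"
      using tilings_step[OF that(1,2) x] by auto
    then have "2 * h i (Suc x) - 2 * h i x \<in> \<int>" by auto
    from Ints_add[OF this I] show ?case by simp
  qed (simp add: tilings_start[OF that(1,2)])
  have "h i x \<in> S" if h: "h \<in> tilings l" "i < l" "x \<le> 2 * l" for h i x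
  proof -
    obtain k where k: "2 * h i x = of_int k" using half[OF h] by (auto elim: Ints_cases)
    have "\<bar>2 * h i x - 2 * real i\<bar> \<le> 2 * real l"
      using tilings_bounds(1)[OF h] h(3) by linarith
    then have "- 2 * int l \<le> k \<and> k \<le> 4 * int l" unfolding k using h(2) by linarith
    moreover have "h i x = of_int k / 2" using k by simp
    ultimately show ?thesis unfolding S_def by auto
  qed
  then have "tilings l \<subseteq> {h. \<forall>i. (i \<in> {..<l} \<longrightarrow> h i \<in> B) \<and> (i \<notin> {..<l} \<longrightarrow> h i = (\<lambda>_. 0))}"
    unfolding B_def by (auto simp: tilings_outside)
  then show ?thesis using fin finite_subset by blast
qed

section \<open>Blocking paths and the validity of a push\<close>

lemma blockers_free:
  assumes "s = 1 \<or> s = -1" "j < l"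
  shows "h j x \<noteq> h i x + s * (real (blockers s l h i x) + 1)"
proof -
  \<comment> \<open>The \<open>LEAST\<close> in \<open>blockers\<close> is attained because
    infinitely many candidate heights cannot all be occupied by \<open>l\<close> paths.\<close>
  have "inj (\<lambda>k::nat. h i x + s * (real k + 1))" using assms by (auto simp: inj_def)
  then have "infinite (range (\<lambda>k::nat. h i x + s * (real k + 1)))"
    using finite_imageD by blast
  then have "\<not> range (\<lambda>k::nat. h i x + s * (real k + 1)) \<subseteq> (\<lambda>j. h j x) ` {..<l}"
    by (meson finite_imageI finite_lessThan finite_subset)
  then obtain k :: nat where "h i x + s * (real k + 1) \<notin> (\<lambda>j. h j x) ` {..<l}" by blast
  then have k: "\<forall>j<l. h j x \<noteq> h i x + s * (real k + 1)" by force
  show ?thesis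
    using LeastI[where P = "\<lambda>k. \<forall>j<l. h j x \<noteq> h i x + s * (real k + 1)", OF k] assms(2)
    unfolding blockers_def by auto
qed

lemma blockers_occupied:
  assumes "m \<le> blockers s l h i x" "i < l"
  shows "\<exists>j<l. h j x = h i x + s * real m"
proof (cases m)
  case 0
  then show ?thesis using assms by auto
next
  \<comment> \<open>\<open>blockers\<close> tests height offset \<open>k + 1\<close> at index
    \<open>k\<close>, so the occupied offset \<open>m = Suc n\<close> is index
    \<open>n\<close>.\<close>
  case (Suc n)
  then have "n < (LEAST k. \<forall>j<l. h j x \<noteq> h i x + s * (real k + 1))"
    using assms unfolding blockers_def by auto
  from not_less_Least[OF this] show ?thesis using Suc by (auto simp: add.commute)
qed

text \<open>Offsets of moved paths are integers, distinct by nonintersection, and fill the whole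
  range by minimality of the free height. Hence exactly \<open>k + 1\<close> paths move, the count
  that the acceptance probability compensates.\<close>

lemma moved_bij:
  assumes s: "s = 1 \<or> s = -1" and h: "h \<in> tilings l" and i: "i < l" and x: "0 < x" "x < 2 * l"
  shows "bij_betw (\<lambda>j. s * (h j x - h i x)) (moved s l h i x) (real ` {..blockers s l h i x})"
proof (rule bij_betwI')
  fix j j' assume "j \<in> moved s l h i x" "j' \<in> moved s l h i x"
  then show "(s * (h j x - h i x) = s * (h j' x - h i x)) = (j = j')"
    using tilings_inj[OF h, of j j' x] s x by (auto simp: moved_def)
next
  fix j assume j: "j \<in> moved s l h i x"
  have "s * (h j x - h i x) \<in> \<int>"
    using tilings_diff_Ints[OF h i, of j x] j x s by (auto simp: moved_def intro: Ints_mult)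
  then obtain k where k: "s * (h j x - h i x) = of_int k" by (auto elim: Ints_cases)
  have "0 \<le> k" "k \<le> int (blockers s l h i x)"
    using j unfolding moved_def mem_Collect_eq k by linarith+
  then have "s * (h j x - h i x) = real (nat k)" "nat k \<le> blockers s l h i x"
    using k by auto
  then show "s * (h j x - h i x) \<in> real ` {..blockers s l h i x}" by auto
next
  fix y assume "y \<in> real ` {..blockers s l h i x}"
  then obtain m where m: "y = real m" "m \<le> blockers s l h i x" by auto
  then obtain j where "j < l" "h j x = h i x + s * real m" using blockers_occupied i by blast
  then have "j \<in> moved s l h i x" "y = s * (h j x - h i x)"
    using m s by (auto simp: moved_def)
  then show "\<exists>j \<in> moved s l h i x. y = s * (h j x - h i x)" by blast
qed

lemma card_moved:
  assumes s: "s = 1 \<or> s = -1" and h: "h \<in> tilings l" and i: "i < l" and x: "0 < x" "x < 2 * l"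
  shows "card (moved s l h i x) = blockers s l h i x + 1"
  using bij_betw_same_card[OF moved_bij[OF assms]] by (simp add: card_image)

lemma blockers_less:
  assumes s: "s = 1 \<or> s = -1" and h: "h \<in> tilings l" and i: "i < l" and x: "0 < x" "x < 2 * l"
  shows "blockers s l h i x + 1 \<le> l"
proof -
  have "card (moved s l h i x) \<le> card {..<l}"
    by (rule card_mono) (auto simp: moved_def)
  then show ?thesis using card_moved[OF assms] by simp
qed

text \<open>A blocking path cannot step onto the extremal path next to it, so it has a local extremum
  of the same kind.\<close>

lemma loc_ext_moved:
  assumes s: "s = 1 \<or> s = -1" and h: "h \<in> tilings l" and i: "i < l" and x: "0 < x" "x < 2 * l"
    and e: "loc_ext s h i x" and j: "j \<in> moved s l h i x"
  shows "loc_ext s h j x"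
proof -
  have "loc_ext s h j x" if "m \<le> blockers s l h i x" "j < l" "h j x = h i x + s * real m" for m j
    using that
  proof (induction m arbitrary: j)
    case 0
    then have "j = i" using tilings_inj[OF h, of j i x] i x by auto
    then show ?case using e by simp
  next
    case (Suc m)
    then obtain j' where j': "j' < l" "h j' x = h i x + s * real m"
      using blockers_occupied[of m s l h i x] i by auto
    with Suc have E: "loc_ext s h j' x" by auto
    have ne: "j \<noteq> j'" using j' Suc.prems s by auto
    have 1: "h j (x - 1) \<noteq> h j' (x - 1)" "h j (Suc x) \<noteq> h j' (Suc x)"
      using tilings_inj[OF h Suc.prems(2) j'(1) _ ne] x by auto
    have 2: "h j (Suc x) = h j x + 1/2 \<or> h j (Suc x) = h j x - 1/2"
      using tilings_step[OF h Suc.prems(2)] x by auto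
    have 3: "h j x = h j (x - 1) + 1/2 \<or> h j x = h j (x - 1) - 1/2"
      using tilings_step[OF h Suc.prems(2), of "x - 1"] x by auto
    have "h j' (x - 1) = h j x - s/2" "h j' (Suc x) = h j x - s/2"
      using E j'(2) Suc.prems(3) unfolding loc_ext_def by (simp_all add: algebra_simps)
    with 1 have "h j (x - 1) \<noteq> h j x - s/2" "h j (Suc x) \<noteq> h j x - s/2" by simp_all
    with 2 3 s show ?case unfolding loc_ext_def by auto
  qed
  moreover obtain m where "m \<le> blockers s l h i x" "s * (h j x - h i x) = real m"
    using moved_bij[OF s h i x] j by (auto simp: bij_betw_def)
  moreover have "h j x = h i x + s * (s * (h j x - h i x))" using s by auto
  moreover have "j < l" using j by (simp add: moved_def)
  ultimately show ?thesis by metis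
qed

text \<open>All moved paths have an extremum of the same kind at \<open>x\<close>, so shifting them
  by \<open>s\<close> only flips both adjacent steps. The point beyond the last blocker is free, so
  no collision arises.\<close>

lemma push_in_tilings:
  assumes s: "s = 1 \<or> s = -1" and h: "h \<in> tilings l" and i: "i < l" and x: "0 < x" "x < 2 * l"
    and e: "loc_ext s h i x"
  shows "push s l h i x \<in> tilings l"
proof -
  let ?g = "push s l h i x"
  have g1: "?g j y = h j y" if "y \<noteq> x \<or> j \<notin> moved s l h i x" for j y
    using that by (auto simp: push_def)
  have g2: "?g j x = h j x + s" if "j \<in> moved s l h i x" for j
    using that by (auto simp: push_def)
  have "?g j (y + 1) = ?g j y + 1/2 \<or> ?g j (y + 1) = ?g j y - 1/2" if "j < l" "y < 2 * l" for j y
  proof -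
    consider "j \<notin> moved s l h i x \<or> (y \<noteq> x \<and> y + 1 \<noteq> x)"
      | "j \<in> moved s l h i x" "y = x" | "j \<in> moved s l h i x" "y + 1 = x" by blast
    then show ?thesis
    proof cases
      case 1
      then show ?thesis using tilings_step[OF h that] g1 by auto
    next
      case 2
      then show ?thesis using loc_ext_moved[OF s h i x e 2(1)] g1[of "y + 1" j] g2[of j] s
        by (auto simp: loc_ext_def)
    next
      case 3
      then show ?thesis using loc_ext_moved[OF s h i x e 3(1)] g1[of y j] g2[of j] s
        by (auto simp: loc_ext_def)
    qed
  qed
  moreover have "?g j y \<noteq> ?g j' y" if jj: "j < l" "j' < l" "y \<le> 2 * l" "j \<noteq> j'" for j j' y
  proof -
    \<comment> \<open>An unmoved path hit by a moved one at offset \<open>m\<close> would have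
      offset \<open>m + 1\<close>; being unmoved, it forces \<open>m\<close> to be the last blocking
      offset, whose successor is free.\<close>
    have mm: "h a x + s \<noteq> h b x"
      if a: "a \<in> moved s l h i x" and b: "b < l" "b \<notin> moved s l h i x" for a b
    proof
      assume eq: "h a x + s = h b x"
      obtain m where m: "m \<le> blockers s l h i x" "s * (h a x - h i x) = real m"
        using moved_bij[OF s h i x] a by (auto simp: bij_betw_def)
      have sb: "s * (h b x - h i x) = real m + 1" using m(2) eq[symmetric] s by auto
      then have "\<not> real m + 1 \<le> real (blockers s l h i x)"
        using b unfolding moved_def by auto
      then have "m = blockers s l h i x" using m(1) by linarith
      then have "h b x = h i x + s * (real (blockers s l h i x) + 1)" using sb s by auto
      then show False using blockers_free[OF s b(1)] by blast
    qed
    show ?thesis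
      using tilings_inj[OF h jj] mm[of j j'] mm[of j' j] jj
      by (cases "y = x"; cases "j \<in> moved s l h i x"; cases "j' \<in> moved s l h i x")
         (auto simp: push_def)
  qed
  moreover have "?g j y = 0" if "\<not> (j < l \<and> y \<le> 2 * l)" for j y
    using that tilings_outside[OF h that] x by (auto simp: push_def moved_def)
  moreover have "?g j 0 = real j \<and> ?g j (2 * l) = real j" if "j < l" for j
    using that x g1[of 0 j] g1[of "2 * l" j] by (simp add: tilings_start[OF h] tilings_end[OF h])
  ultimately show ?thesis unfolding tilings_def by blast
qed

text \<open>The weight \<open>w\<close> is left general: the sine gives \<open>Phi\<close>, the
  constant 1 gives the volume used for reachability.\<close>

lemma sum_push:
  assumes s: "s = 1 \<or> s = -1" and h: "h \<in> tilings l" and i: "i < l" and x: "0 < x" "x < 2 * l"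
  shows "(\<Sum>y\<in>{1..2 * l - 1}. w y * (\<Sum>j<l. push s l h i x j y - real j)) =
   (\<Sum>y\<in>{1..2 * l - 1}. w y * (\<Sum>j<l. h j y - real j)) + w x * s * (real (blockers s l h i x) + 1)"
proof -
  have "(\<Sum>j<l. push s l h i x j y - real j) =
      (\<Sum>j<l. h j y - real j) + (if y = x then s * (real (blockers s l h i x) + 1) else 0)" for y
  proof -
    have "(\<Sum>j<l. push s l h i x j y - real j) =
        (\<Sum>j<l. h j y - real j) + (\<Sum>j<l. if y = x \<and> j \<in> moved s l h i x then s else 0)"
      unfolding sum.distrib[symmetric] by (rule sum.cong) (auto simp: push_def)
    also have "(\<Sum>j<l. if y = x \<and> j \<in> moved s l h i x then s else 0) =
        (if y = x then \<Sum>j\<in>moved s l h i x. s else 0)"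
    proof -
      have "{..<l} \<inter> moved s l h i x = moved s l h i x" by (auto simp: moved_def)
      then show ?thesis by (simp add: sum.inter_restrict[symmetric])
    qed
    finally show ?thesis using card_moved[OF assms] by (simp add: mult.commute)
  qed
  then show ?thesis
    using x by (simp add: distrib_left sum.distrib if_distrib[of "(*) _"] mult.assoc
        cong: if_cong)
qed

section \<open>Total variation distance\<close>

lemma tv_dist_finite:
  assumes "finite A" "set_pmf p \<subseteq> A" "set_pmf q \<subseteq> A"
  shows "tv_dist p q = 1/2 * (\<Sum>z\<in>A. \<bar>pmf p z - pmf q z\<bar>)"
proof -
  have "pmf p z = 0" "pmf q z = 0" if "z \<notin> A" for z
    using assms that by (auto simp: pmf_eq_0_set_pmf)
  then have "(\<Sum>\<^sub>\<infinity>z. \<bar>pmf p z - pmf q z\<bar>) = (\<Sum>\<^sub>\<infinity>z\<in>A. \<bar>pmf p z - pmf q z\<bar>)"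
    by (intro infsum_cong_neutral) auto
  then show ?thesis using assms by (simp add: tv_dist_def)
qed

lemma expectation_finite:
  fixes f :: "'a \<Rightarrow> real"
  assumes "finite A" "set_pmf p \<subseteq> A"
  shows "measure_pmf.expectation p f = (\<Sum>z\<in>A. pmf p z * f z)"
  using integral_measure_pmf[OF assms(1), of p f] assms(2) by auto

text \<open>Cauchy--Schwarz with respect to the weights \<open>|p - q| \<le> p + q\<close>.\<close>

lemma tv_dist_ge_moments:
  fixes f :: "'a \<Rightarrow> real"
  assumes A: "finite A" "set_pmf p \<subseteq> A" "set_pmf q \<subseteq> A"
  shows "(measure_pmf.expectation p f - measure_pmf.expectation q f)\<^sup>2 \<le>
    2 * tv_dist p q *
      (measure_pmf.expectation p (\<lambda>z. (f z)\<^sup>2) + measure_pmf.expectation q (\<lambda>z. (f z)\<^sup>2))"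
proof -
  define w where "w z = \<bar>pmf p z - pmf q z\<bar>" for z
  have "\<bar>measure_pmf.expectation p f - measure_pmf.expectation q f\<bar> =
      \<bar>\<Sum>z\<in>A. (pmf p z - pmf q z) * f z\<bar>"
    using A by (simp add: expectation_finite[where A = A] sum_subtractf left_diff_distrib)
  also have "\<dots> \<le> (\<Sum>z\<in>A. \<bar>(pmf p z - pmf q z) * f z\<bar>)" by (rule sum_abs)
  also have "\<dots> = (\<Sum>z\<in>A. sqrt (w z) * (sqrt (w z) * \<bar>f z\<bar>))"
  proof (rule sum.cong)
    fix z
    have "sqrt (w z) * sqrt (w z) = w z" by (simp add: w_def)
    then show "\<bar>(pmf p z - pmf q z) * f z\<bar> = sqrt (w z) * (sqrt (w z) * \<bar>f z\<bar>)"
      by (metis abs_mult mult.assoc w_def)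
  qed simp
  finally have "\<bar>measure_pmf.expectation p f - measure_pmf.expectation q f\<bar> \<le>
      \<bar>\<Sum>z\<in>A. sqrt (w z) * (sqrt (w z) * \<bar>f z\<bar>)\<bar>"
    by linarith
  then have "(measure_pmf.expectation p f - measure_pmf.expectation q f)\<^sup>2 \<le>
      (\<Sum>z\<in>A. sqrt (w z) * (sqrt (w z) * \<bar>f z\<bar>))\<^sup>2"
    unfolding abs_le_square_iff .
  also have "\<dots> \<le> (\<Sum>z\<in>A. (sqrt (w z))\<^sup>2) * (\<Sum>z\<in>A. (sqrt (w z) * \<bar>f z\<bar>)\<^sup>2)"
    by (rule Cauchy_Schwarz_ineq_sum)
  also have "\<dots> = (\<Sum>z\<in>A. w z) * (\<Sum>z\<in>A. w z * (f z)\<^sup>2)"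
    by (simp add: power_mult_distrib w_def)
  also have "\<dots> \<le> (\<Sum>z\<in>A. w z) * (\<Sum>z\<in>A. (pmf p z + pmf q z) * (f z)\<^sup>2)"
  proof (intro mult_left_mono sum_mono mult_right_mono)
    fix z show "w z \<le> pmf p z + pmf q z"
      using pmf_nonneg[of p z] pmf_nonneg[of q z] unfolding w_def by linarith
  qed (auto simp: w_def intro: sum_nonneg)
  also have "\<dots> = 2 * tv_dist p q *
      (measure_pmf.expectation p (\<lambda>z. (f z)\<^sup>2) + measure_pmf.expectation q (\<lambda>z. (f z)\<^sup>2))"
    using A by (simp add: expectation_finite[where A = A] tv_dist_finite[where A = A] w_def
        sum.distrib distrib_right)
  finally show ?thesis .
qed

text \<open>Doeblin's argument: the part of the kernel common to all starting points cancels.\<close>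

lemma tv_dist_bind_le:
  assumes A: "finite A" "set_pmf p \<subseteq> A" "set_pmf q \<subseteq> A"
    and K: "\<And>a. a \<in> A \<Longrightarrow> set_pmf (K a) \<subseteq> A"
    and c: "c \<in> A" "\<And>a. a \<in> A \<Longrightarrow> \<delta> \<le> pmf (K a) c"
  shows "tv_dist (bind_pmf p K) (bind_pmf q K) \<le> (1 - \<delta>) * tv_dist p q"
proof -
  define d where "d a = pmf p a - pmf q a" for a
  \<comment> \<open>\<open>e\<close> is the mass \<delta> at \<open>c\<close> shared by all rows of
    the kernel. As \<open>d\<close> sums to 0, subtracting \<open>e\<close> changes nothing; the
    rows stay nonnegative, so absolute values fall on \<open>d\<close> alone, and each row keeps
    total mass \<open>1 - \<delta>\<close>.\<close>
  define e where "e z = (if z = c then \<delta> else 0)" for z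
  have bind: "pmf (bind_pmf r K) z = (\<Sum>a\<in>A. pmf r a * pmf (K a) z)" if "set_pmf r \<subseteq> A" for r z
    using A that by (simp add: pmf_bind expectation_finite)
  have sum1: "(\<Sum>z\<in>A. pmf r z) = 1" if "set_pmf r \<subseteq> A" for r
    using that A by (simp add: sum_pmf_eq_1)
  have d0: "(\<Sum>a\<in>A. d a) = 0"
    using sum1 A by (simp add: d_def sum_subtractf)
  have "(\<Sum>z\<in>A. \<bar>pmf (bind_pmf p K) z - pmf (bind_pmf q K) z\<bar>) =
      (\<Sum>z\<in>A. \<bar>\<Sum>a\<in>A. d a * (pmf (K a) z - e z)\<bar>)"
  proof (intro sum.cong refl arg_cong[where f = abs])
    fix z
    have "(\<Sum>a\<in>A. d a * (pmf (K a) z - e z)) =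
        (\<Sum>a\<in>A. d a * pmf (K a) z) - (\<Sum>a\<in>A. d a) * e z"
      by (simp add: right_diff_distrib sum_subtractf sum_distrib_right)
    then show "pmf (bind_pmf p K) z - pmf (bind_pmf q K) z =
        (\<Sum>a\<in>A. d a * (pmf (K a) z - e z))"
      using A by (simp add: bind d0) (simp add: d_def left_diff_distrib sum_subtractf)
  qed
  also have "\<dots> \<le> (\<Sum>z\<in>A. \<Sum>a\<in>A. \<bar>d a\<bar> * (pmf (K a) z - e z))"
  proof (rule sum_mono)
    fix z assume "z \<in> A"
    have "\<bar>\<Sum>a\<in>A. d a * (pmf (K a) z - e z)\<bar> \<le> (\<Sum>a\<in>A. \<bar>d a * (pmf (K a) z - e z)\<bar>)"
      by (rule sum_abs)
    also have "\<dots> = (\<Sum>a\<in>A. \<bar>d a\<bar> * (pmf (K a) z - e z))"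
      using c by (intro sum.cong) (auto simp: abs_mult e_def)
    finally show "\<bar>\<Sum>a\<in>A. d a * (pmf (K a) z - e z)\<bar> \<le> (\<Sum>a\<in>A. \<bar>d a\<bar> * (pmf (K a) z - e z))" .
  qed
  also have "\<dots> = (\<Sum>a\<in>A. \<bar>d a\<bar> * (\<Sum>z\<in>A. pmf (K a) z - e z))"
    by (subst sum.swap) (simp add: sum_distrib_left)
  also have "\<dots> = (\<Sum>a\<in>A. \<bar>d a\<bar> * (1 - \<delta>))"
    using sum1 K A c by (intro sum.cong) (auto simp: sum_subtractf e_def)
  also have "\<dots> = (1 - \<delta>) * (\<Sum>a\<in>A. \<bar>d a\<bar>)"
    by (simp add: sum_distrib_left mult.commute)
  finally have main: "(\<Sum>z\<in>A. \<bar>pmf (bind_pmf p K) z - pmf (bind_pmf q K) z\<bar>) \<le>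
      (1 - \<delta>) * (\<Sum>a\<in>A. \<bar>d a\<bar>)" .
  have "set_pmf (bind_pmf p K) \<subseteq> A" "set_pmf (bind_pmf q K) \<subseteq> A"
    using A K by auto
  with main A show ?thesis
    by (simp add: tv_dist_finite[where A = A] d_def)
qed

lemma tv_dist_le_1:
  assumes "finite A" "set_pmf p \<subseteq> A" "set_pmf q \<subseteq> A"
  shows "tv_dist p q \<le> 1"
proof -
  have "(\<Sum>z\<in>A. \<bar>pmf p z - pmf q z\<bar>) \<le> (\<Sum>z\<in>A. pmf p z + pmf q z)"
  proof (rule sum_mono)
    fix z show "\<bar>pmf p z - pmf q z\<bar> \<le> pmf p z + pmf q z"
      using pmf_nonneg[of p z] pmf_nonneg[of q z] by linarith
  qed
  also have "\<dots> = 2" using assms by (simp add: sum.distrib sum_pmf_eq_1)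
  finally show ?thesis using assms by (simp add: tv_dist_finite)
qed

section \<open>The eigenfunction\<close>

lemma finite_internal_points: "finite (internal_points l)"
  by (simp add: internal_points_def)

lemma internal_points_nonempty: "1 \<le> l \<Longrightarrow> internal_points l \<noteq> {}"
  by (simp add: internal_points_def)

lemma card_internal_points: "card (internal_points l) = l * (2 * l - 1)"
  by (simp add: internal_points_def)

section \<open>One step of the chain as an average over points and signs\<close>

definition attempt :: "nat \<Rightarrow> path_family \<Rightarrow> real \<Rightarrow> nat \<Rightarrow> nat \<Rightarrow> path_family pmf" where
  "attempt l h s i x =
     (if loc_ext s h i x then
        map_pmf (\<lambda>accept. if accept then push s l h i x else h)
          (bernoulli_pmf (1 / (real (blockers s l h i x) + 1)))
      else return_pmf h)"

lemma lrs_step_attempt: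
  "lrs_step l h = bind_pmf (pmf_of_set (internal_points l)) (\<lambda>p.
     bind_pmf (bernoulli_pmf (1/2)) (\<lambda>up. attempt l h (if up then 1 else -1) (fst p) (snd p)))"
  unfolding lrs_step_def attempt_def local_min_eq local_max_eq blockers_up_eq blockers_down_eq
    push_up_eq push_down_eq case_prod_beta
  by (intro bind_pmf_cong refl) auto

lemma set_attempt:
  assumes "s = 1 \<or> s = -1" "h \<in> tilings l" "p \<in> internal_points l"
  shows "set_pmf (attempt l h s (fst p) (snd p)) \<subseteq> tilings l"
proof -
  have "fst p < l" "0 < snd p" "snd p < 2 * l"
    using assms(3) by (auto simp: internal_points_def)
  with push_in_tilings[OF assms(1,2) this] assms(2) show ?thesis
    by (auto simp: attempt_def)
qed

lemma set_lrs_step: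
  assumes "1 \<le> l"
  shows "set_pmf (lrs_step l h) =
    (\<Union>p\<in>internal_points l. \<Union>s\<in>{1, -1}. set_pmf (attempt l h s (fst p) (snd p)))"
proof -
  have "(\<Union>up::bool. set_pmf (attempt l h (if up then 1 else -1) i x)) =
      (\<Union>s\<in>{1, -1}. set_pmf (attempt l h s i x))" for i x
    by (simp add: UNIV_bool Un_commute)
  then show ?thesis
    using assms by (simp add: lrs_step_attempt set_pmf_of_set set_pmf_bernoulli
        internal_points_nonempty finite_internal_points)
qed

lemma lrs_step_closed:
  assumes "1 \<le> l" "h \<in> tilings l"
  shows "set_pmf (lrs_step l h) \<subseteq> tilings l"
  unfolding set_lrs_step[OF assms(1)] using set_attempt[OF _ assms(2)] by (intro UN_least) auto

lemma set_lrs_law: "1 \<le> l \<Longrightarrow> h \<in> tilings l \<Longrightarrow> set_pmf (lrs_law l h t) \<subseteq> tilings l"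
  by (induction t) (use lrs_step_closed in auto)

lemma expectation_attempt:
  fixes f :: "path_family \<Rightarrow> real"
  shows "measure_pmf.expectation (attempt l h s i x) f =
    f h + (if loc_ext s h i x then (f (push s l h i x) - f h) / (real (blockers s l h i x) + 1) else 0)"
  by (simp add: attempt_def right_diff_distrib diff_divide_distrib)

text \<open>This is the generator of the chain applied to \<open>f\<close>: the normalisation counts
  \<open>l * (2 * l - 1)\<close> points and two directions.\<close>

lemma expectation_lrs_step:
  fixes f :: "path_family \<Rightarrow> real"
  assumes "1 \<le> l"
  shows "measure_pmf.expectation (lrs_step l h) f =
    f h + (\<Sum>p\<in>internal_points l. \<Sum>s\<in>{1, -1}. if loc_ext s h (fst p) (snd p)
      then (f (push s l h (fst p) (snd p)) - f h) / (real (blockers s l h (fst p) (snd p)) + 1)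
      else 0) / (2 * real (l * (2 * l - 1)))"
proof -
  define D where "D s p = (if loc_ext s h (fst p) (snd p)
      then (f (push s l h (fst p) (snd p)) - f h) / (real (blockers s l h (fst p) (snd p)) + 1)
      else 0)" for s p
  have fin: "finite (set_pmf (attempt l h s i x))" for s i x by (simp add: attempt_def)
  have inner: "measure_pmf.expectation (bind_pmf (bernoulli_pmf (1/2))
      (\<lambda>up. attempt l h (if up then 1 else -1) (fst p) (snd p))) f = f h + (D 1 p + D (-1) p) / 2" for p
    by (subst pmf_expectation_bind[where A = UNIV])
       (auto simp: fin UNIV_bool expectation_attempt D_def field_simps)
  have "measure_pmf.expectation (lrs_step l h) f =
      (\<Sum>p\<in>internal_points l. (f h + (D 1 p + D (-1) p) / 2) /\<^sub>R real (card (internal_points l)))"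
    unfolding lrs_step_attempt using assms
    by (subst pmf_expectation_bind_pmf_of_set)
       (auto simp: finite_internal_points internal_points_nonempty fin inner)
  also have "\<dots> =
      (\<Sum>p\<in>internal_points l. f h + (D 1 p + D (-1) p) / 2) / real (card (internal_points l))"
    unfolding real_scaleR_def sum_distrib_left[symmetric] by (rule divide_inverse_commute[symmetric])
  also have "\<dots> = f h + (\<Sum>p\<in>internal_points l. D 1 p + D (-1) p) / (2 * real (l * (2 * l - 1)))"
  proof -
    define c where "c = real (l * (2 * l - 1))"
    have "c \<noteq> 0" using assms by (simp add: c_def)
    then show ?thesis
      unfolding sum.distrib sum_divide_distrib[symmetric] sum_constant card_internal_points
        c_def[symmetric]
      by (simp add: add_divide_distrib)
  qed
  finally show ?thesis by (simp add: D_def)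
qed

text \<open>Measuring path \<open>j\<close> from its starting height \<open>j\<close> makes the
  displacement vanish at \<open>0\<close> and \<open>2 * l\<close>, which summation by parts
  requires.\<close>

definition Phi :: "nat \<Rightarrow> path_family \<Rightarrow> real" where
  "Phi l h = (\<Sum>x\<in>{1..2 * l - 1}. sin (pi * real x / (2 * real l)) * (\<Sum>j<l. h j x - real j))"

text \<open>The Laplacian eigenvalue \<open>2 - 2 * cos (pi / (2 * l))\<close> divided by the
  normalisation \<open>2 * l * (2 * l - 1)\<close>.\<close>

definition gap :: "nat \<Rightarrow> real" where
  "gap l = (1 - cos (pi / (2 * real l))) / (real l * (2 * real l - 1))"

lemma Phi_push:
  assumes "s = 1 \<or> s = -1" "h \<in> tilings l" "i < l" "0 < x" "x < 2 * l"
  shows "Phi l (push s l h i x) - Phi l h =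
    s * (real (blockers s l h i x) + 1) * sin (pi * real x / (2 * real l))"
  unfolding Phi_def sum_push[OF assms] by simp

section \<open>Summation by parts against the sine\<close>

lemma sum_by_parts:
  fixes g w :: "nat \<Rightarrow> real"
  assumes "0 < n" "g 0 = 0" "g n = 0" "w 0 = 0" "w n = 0"
  shows "(\<Sum>x\<in>{1..n - 1}. w x * (g (x - 1) + g (x + 1) - 2 * g x)) =
         (\<Sum>x\<in>{1..n - 1}. (w (x - 1) + w (x + 1) - 2 * w x) * g x)"
proof -
  \<comment> \<open>The discrete Wronskian of \<open>w\<close> and \<open>g\<close>: its increments
    are the differences of the two summands, and it vanishes at both ends by the boundary
    values.\<close>
  define T where "T x = w x * g (x + 1) - w (x + 1) * g x" for x
  have "(\<Sum>x\<in>{1..n - 1}. w x * (g (x - 1) + g (x + 1) - 2 * g x)) -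
        (\<Sum>x\<in>{1..n - 1}. (w (x - 1) + w (x + 1) - 2 * w x) * g x) =
        (\<Sum>x\<in>{Suc 0..n - 1}. T x - T (x - 1))"
    unfolding sum_subtractf[symmetric]
    by (rule sum.cong) (auto simp: T_def algebra_simps)
  also have "\<dots> = T (n - 1) - T 0" using sum_telescope''[of 0 "n - 1" T] by simp
  also have "\<dots> = 0" using assms by (simp add: T_def)
  finally show ?thesis by simp
qed

lemma sin_second_difference:
  fixes \<theta> :: real
  assumes "0 < x"
  shows "sin (\<theta> * real (x - 1)) + sin (\<theta> * real (x + 1)) - 2 * sin (\<theta> * real x) =
    - (2 - 2 * cos \<theta>) * sin (\<theta> * real x)"
proof -
  have 1: "\<theta> * real (x - 1) = \<theta> * real x - \<theta>" "\<theta> * real (x + 1) = \<theta> * real x + \<theta>"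
    using assms by (auto simp: of_nat_diff algebra_simps)
  show ?thesis unfolding 1 sin_add sin_diff by (simp add: algebra_simps)
qed

lemma sum_sin_second_difference:
  fixes g :: "nat \<Rightarrow> real"
  assumes "1 \<le> l" "g 0 = 0" "g (2 * l) = 0"
  shows "(\<Sum>x\<in>{1..2 * l - 1}. sin (pi * real x / (2 * real l)) * (g (x - 1) + g (x + 1) - 2 * g x)) =
    - (2 - 2 * cos (pi / (2 * real l))) * (\<Sum>x\<in>{1..2 * l - 1}. sin (pi * real x / (2 * real l)) * g x)"
proof -
  let ?\<theta> = "pi / (2 * real l)"
  have s: "sin (pi * real x / (2 * real l)) = sin (?\<theta> * real x)" for x by simp
  have "(\<Sum>x\<in>{1..2 * l - 1}. sin (?\<theta> * real x) * (g (x - 1) + g (x + 1) - 2 * g x)) =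
      (\<Sum>x\<in>{1..2 * l - 1}. (sin (?\<theta> * real (x - 1)) + sin (?\<theta> * real (x + 1)) -
         2 * sin (?\<theta> * real x)) * g x)"
    by (rule sum_by_parts) (use assms in auto)
  also have "\<dots> = (\<Sum>x\<in>{1..2 * l - 1}. - (2 - 2 * cos ?\<theta>) * (sin (?\<theta> * real x) * g x))"
  proof (rule sum.cong)
    fix x assume "x \<in> {1..2 * l - 1}"
    then have "0 < x" by simp
    from sin_second_difference[OF this, of ?\<theta>]
    show "(sin (?\<theta> * real (x - 1)) + sin (?\<theta> * real (x + 1)) - 2 * sin (?\<theta> * real x)) * g x =
        - (2 - 2 * cos ?\<theta>) * (sin (?\<theta> * real x) * g x)"
      by (simp only: mult.assoc)
  qed simp
  finally show ?thesis unfolding s sum_distrib_left .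
qed

text \<open>Steps are half-units up or down, so the second difference is 1 at a local minimum, -1 at
  a local maximum and 0 elsewhere. This makes the drift linear in the heights.\<close>

lemma loc_ext_second_difference:
  assumes "h \<in> tilings l" "i < l" "0 < x" "x < 2 * l"
  shows "(if loc_ext 1 h i x then 1 else 0) - (if loc_ext (-1) h i x then 1 else 0) =
    h i (x - 1) + h i (x + 1) - 2 * h i x"
proof -
  obtain y where x: "x = Suc y" using assms(3) by (cases x) auto
  then have "y < 2 * l" using assms(4) by simp
  then show ?thesis
    using tilings_step[OF assms(1,2,4)] tilings_step[OF assms(1,2), of y]
    by (auto simp: loc_ext_def x)
qed

lemma expectation_Phi_step:
  assumes l: "1 \<le> l" and h: "h \<in> tilings l"
  shows "measure_pmf.expectation (lrs_step l h) (Phi l) = (1 - gap l) * Phi l h"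
proof -
  define g where "g i x = h i x - real i" for i x
  let ?w = "\<lambda>x. sin (pi * real x / (2 * real l))"
  have "(\<Sum>p\<in>internal_points l. \<Sum>s\<in>{1, -1}. if loc_ext s h (fst p) (snd p)
      then (Phi l (push s l h (fst p) (snd p)) - Phi l h) / (real (blockers s l h (fst p) (snd p)) + 1)
      else 0) = (\<Sum>p\<in>{0..<l} \<times> {1..2 * l - 1}.
        ?w (snd p) * (g (fst p) (snd p - 1) + g (fst p) (snd p + 1) - 2 * g (fst p) (snd p)))"
    unfolding internal_points_def
  proof (rule sum.cong)
    fix p assume "p \<in> {0..<l} \<times> {1..2 * l - 1}"
    then have p: "fst p < l" "0 < snd p" "snd p < 2 * l" by auto
    show "(\<Sum>s\<in>{1, -1}. if loc_ext s h (fst p) (snd p)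
      then (Phi l (push s l h (fst p) (snd p)) - Phi l h) / (real (blockers s l h (fst p) (snd p)) + 1)
      else 0) = ?w (snd p) * (g (fst p) (snd p - 1) + g (fst p) (snd p + 1) - 2 * g (fst p) (snd p))"
    proof -
      \<comment> \<open>The number of moved paths cancels against the acceptance probability, so
        blocking leaves no trace in the drift.\<close>
      have "(Phi l (push s l h (fst p) (snd p)) - Phi l h) / (real (blockers s l h (fst p) (snd p)) + 1)
          = s * ?w (snd p)" if "s = 1 \<or> s = -1" for s
        unfolding Phi_push[OF that h p] by simp
      then have "(\<Sum>s\<in>{1, -1}. if loc_ext s h (fst p) (snd p)
          then (Phi l (push s l h (fst p) (snd p)) - Phi l h) / (real (blockers s l h (fst p) (snd p)) + 1)
          else 0) = ?w (snd p) * ((if loc_ext 1 h (fst p) (snd p) then 1 else 0) -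
             (if loc_ext (-1) h (fst p) (snd p) then 1 else 0))"
        by simp
      then show ?thesis unfolding loc_ext_second_difference[OF h p] by (simp add: g_def)
    qed
  qed simp
  also have "\<dots> = (\<Sum>i\<in>{0..<l}. \<Sum>x\<in>{1..2 * l - 1}. ?w x * (g i (x - 1) + g i (x + 1) - 2 * g i x))"
    by (simp add: sum.cartesian_product case_prod_unfold)
  also have "\<dots> = (\<Sum>i\<in>{0..<l}. - (2 - 2 * cos (pi / (2 * real l))) * (\<Sum>x\<in>{1..2 * l - 1}. ?w x * g i x))"
    using l by (intro sum.cong sum_sin_second_difference)
      (auto simp: g_def tilings_start[OF h] tilings_end[OF h])
  also have "\<dots> = - (2 - 2 * cos (pi / (2 * real l))) * Phi l h"
    unfolding Phi_def g_def
    by (subst sum_distrib_left[symmetric], subst sum.swap)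
       (simp add: sum_distrib_left atLeast0LessThan)
  finally have "measure_pmf.expectation (lrs_step l h) (Phi l) =
      Phi l h + - (2 - 2 * cos (pi / (2 * real l))) * Phi l h / (2 * real (l * (2 * l - 1)))"
    unfolding expectation_lrs_step[OF l] by (rule arg_cong)
  also have "\<dots> = (1 - gap l) * Phi l h"
    using l unfolding gap_def by (simp add: of_nat_diff divide_simps) (simp add: algebra_simps)
  finally show ?thesis .
qed

text \<open>Squaring the change of \<open>Phi\<close> gives \<open>(k + 1)\<^sup>2\<close>, and
  acceptance removes one factor; what is left is at most \<open>k + 1\<close>, hence at most
  \<open>l\<close>.\<close>

lemma expectation_Phi_step_sq:
  assumes l: "1 \<le> l" and h: "h \<in> tilings l"
  shows "measure_pmf.expectation (lrs_step l h) (\<lambda>g. (Phi l g - Phi l h)\<^sup>2) \<le> real l"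
proof -
  have "(\<Sum>p\<in>internal_points l. \<Sum>s\<in>{1, -1}. if loc_ext s h (fst p) (snd p)
      then ((Phi l (push s l h (fst p) (snd p)) - Phi l h)\<^sup>2 - (Phi l h - Phi l h)\<^sup>2) /
        (real (blockers s l h (fst p) (snd p)) + 1)
      else 0) \<le> (\<Sum>p\<in>internal_points l. \<Sum>s\<in>{1, -1::real}. real l)"
  proof (intro sum_mono)
    fix p s assume "p \<in> internal_points l" and s: "s \<in> {1, -1::real}"
    then have p: "fst p < l" "0 < snd p" "snd p < 2 * l" by (auto simp: internal_points_def)
    define b where "b = real (blockers s l h (fst p) (snd p)) + 1"
    define w where "w = sin (pi * real (snd p) / (2 * real l))"
    have s': "s = 1 \<or> s = -1" using s by simp
    have b: "0 < b" "b \<le> real l" using blockers_less[OF s' h p] by (auto simp: b_def)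
    have "(Phi l (push s l h (fst p) (snd p)) - Phi l h)\<^sup>2 / b = (s * b * w)\<^sup>2 / b"
      unfolding Phi_push[OF s' h p] b_def w_def ..
    also have "\<dots> = b * w\<^sup>2" using s' b by (auto simp: power2_eq_square)
    also have "\<dots> \<le> real l * 1"
      using b by (intro mult_mono) (auto simp: w_def abs_square_le_1)
    finally show "(if loc_ext s h (fst p) (snd p)
      then ((Phi l (push s l h (fst p) (snd p)) - Phi l h)\<^sup>2 - (Phi l h - Phi l h)\<^sup>2) /
        (real (blockers s l h (fst p) (snd p)) + 1)
      else 0) \<le> real l" by (simp add: b_def)
  qed
  also have "\<dots> = real l * (2 * real (l * (2 * l - 1)))"
    by (simp add: card_internal_points)
  finally show ?thesis
    unfolding expectation_lrs_step[OF l] using l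
    by (simp add: divide_le_eq)
qed

section \<open>Moments of the eigenfunction\<close>

lemma cos_half_angle_less_1:
  assumes "1 \<le> l"
  shows "cos (pi / (2 * real l)) < 1"
proof -
  have "pi / (2 * real l) \<le> pi" using assms by (simp add: divide_le_eq)
  then have "cos (pi / (2 * real l)) < cos 0"
    using assms by (intro cos_monotone_0_pi) auto
  then show ?thesis by simp
qed

lemma gap_pos: "1 \<le> l \<Longrightarrow> 0 < gap l"
  using cos_half_angle_less_1[of l] by (simp add: gap_def)

text \<open>Keeps \<open>1 - 2 * gap l\<close> nonnegative in the second-moment recursion and
  \<open>1 - gap l\<close> positive under the logarithm. At \<open>l = 1\<close> the gap equals 1,
  whence \<open>2 \<le> l\<close> from here on.\<close>

lemma gap_le_half:
  assumes "2 \<le> l"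
  shows "gap l \<le> 1/2"
proof -
  have "2 * 3 \<le> real l * (2 * real l - 1)" using assms by (intro mult_mono) auto
  moreover have "1 - cos (pi / (2 * real l)) \<le> 2"
    using cos_ge_minus_one[of "pi / (2 * real l)"] by linarith
  ultimately have "1 - cos (pi / (2 * real l)) \<le> 1/2 * (real l * (2 * real l - 1))" by linarith
  then show ?thesis
    unfolding gap_def using assms by (subst pos_divide_le_eq) auto
qed

section \<open>First and second moments at time \<open>t\<close>\<close>

lemma expectation_bind_finite:
  fixes f :: "'b \<Rightarrow> real"
  assumes "finite A" "set_pmf p \<subseteq> A" "\<And>a. a \<in> A \<Longrightarrow> finite (set_pmf (K a))"
  shows "measure_pmf.expectation (bind_pmf p K) f =
    (\<Sum>a\<in>A. pmf p a * measure_pmf.expectation (K a) f)"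
  using assms by (subst pmf_expectation_bind[where A = A]) auto

lemma expectation_lrs_law_Suc:
  fixes f :: "path_family \<Rightarrow> real"
  assumes "1 \<le> l" "h \<in> tilings l"
  shows "measure_pmf.expectation (lrs_law l h (Suc t)) f =
    (\<Sum>g\<in>tilings l. pmf (lrs_law l h t) g * measure_pmf.expectation (lrs_step l g) f)"
  unfolding lrs_law.simps using assms
  by (intro expectation_bind_finite finite_tilings set_lrs_law)
     (auto intro: finite_subset[OF lrs_step_closed finite_tilings])

lemma expectation_Phi_law:
  assumes "1 \<le> l" "h \<in> tilings l"
  shows "measure_pmf.expectation (lrs_law l h t) (Phi l) = (1 - gap l) ^ t * Phi l h"
proof (induction t)
  case (Suc t)
  have "measure_pmf.expectation (lrs_law l h (Suc t)) (Phi l) =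
      (1 - gap l) * (\<Sum>g\<in>tilings l. pmf (lrs_law l h t) g * Phi l g)"
    unfolding expectation_lrs_law_Suc[OF assms] sum_distrib_left
    using assms(1) by (intro sum.cong) (auto simp: expectation_Phi_step)
  also have "\<dots> = (1 - gap l) * measure_pmf.expectation (lrs_law l h t) (Phi l)"
    using expectation_finite[OF finite_tilings set_lrs_law[OF assms]] by simp
  finally show ?case using Suc by simp
qed simp

text \<open>Expanding the square around \<open>Phi l h\<close> leaves the mean square increment, at
  most \<open>l\<close>, and a term linear in \<open>Phi\<close>, where the eigenvalue equation
  applies.\<close>

lemma expectation_Phi_sq_step:
  assumes l: "1 \<le> l" and h: "h \<in> tilings l"
  shows "measure_pmf.expectation (lrs_step l h) (\<lambda>g. (Phi l g)\<^sup>2) \<le>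
    (1 - 2 * gap l) * (Phi l h)\<^sup>2 + real l"
proof -
  have int: "integrable (measure_pmf (lrs_step l h)) f" for f :: "path_family \<Rightarrow> real"
    by (intro integrable_measure_pmf_finite finite_subset[OF lrs_step_closed[OF l h] finite_tilings])
  have "measure_pmf.expectation (lrs_step l h) (\<lambda>g. (Phi l g)\<^sup>2) =
      measure_pmf.expectation (lrs_step l h)
        (\<lambda>g. (Phi l g - Phi l h)\<^sup>2 + (2 * Phi l h * Phi l g - (Phi l h)\<^sup>2))"
    by (simp add: power2_eq_square algebra_simps)
  also have "\<dots> = measure_pmf.expectation (lrs_step l h) (\<lambda>g. (Phi l g - Phi l h)\<^sup>2) +
      (2 * Phi l h * ((1 - gap l) * Phi l h) - (Phi l h)\<^sup>2)"
    unfolding expectation_Phi_step[OF l h, symmetric]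
    by (subst Bochner_Integration.integral_add[OF int int],
        subst Bochner_Integration.integral_diff[OF int int]) simp
  also have "\<dots> \<le> real l + (2 * Phi l h * ((1 - gap l) * Phi l h) - (Phi l h)\<^sup>2)"
    using expectation_Phi_step_sq[OF l h] by simp
  also have "\<dots> = (1 - 2 * gap l) * (Phi l h)\<^sup>2 + real l"
    by (simp add: power2_eq_square algebra_simps)
  finally show ?thesis .
qed

text \<open>The constant \<open>l / (2 * gap l)\<close> is the fixed point of
  \<open>v \<mapsto> (1 - 2 * gap l) * v + l\<close>, so this variance bound is preserved by the
  recursion.\<close>

lemma expectation_Phi_sq_law:
  assumes l: "2 \<le> l" and h: "h \<in> tilings l"
  shows "measure_pmf.expectation (lrs_law l h t) (\<lambda>g. (Phi l g)\<^sup>2) \<le>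
    ((1 - gap l) ^ t * Phi l h)\<^sup>2 + real l / (2 * gap l)"
proof (induction t)
  case 0
  have "0 < gap l" using gap_pos l by simp
  then show ?case by simp
next
  case (Suc t)
  have l1: "1 \<le> l" using l by simp
  let ?m = "(1 - gap l) ^ t * Phi l h"
  have g: "0 < gap l" "gap l \<le> 1/2" using gap_pos gap_le_half l by auto
  have "measure_pmf.expectation (lrs_law l h (Suc t)) (\<lambda>g. (Phi l g)\<^sup>2) \<le>
      (\<Sum>g\<in>tilings l. pmf (lrs_law l h t) g * ((1 - 2 * gap l) * (Phi l g)\<^sup>2 + real l))"
    unfolding expectation_lrs_law_Suc[OF l1 h]
    by (intro sum_mono mult_left_mono expectation_Phi_sq_step[OF l1]) auto
  also have "\<dots> = (1 - 2 * gap l) * measure_pmf.expectation (lrs_law l h t) (\<lambda>g. (Phi l g)\<^sup>2) + real l"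
    unfolding expectation_finite[OF finite_tilings set_lrs_law[OF l1 h]] sum_distrib_left
    using sum_pmf_eq_1[OF finite_tilings set_lrs_law[OF l1 h], of t]
    by (simp add: distrib_left sum.distrib mult_ac flip: sum_distrib_left)
  also have "\<dots> \<le> (1 - 2 * gap l) * (?m\<^sup>2 + real l / (2 * gap l)) + real l"
    using g Suc by (intro add_right_mono mult_left_mono) auto
  also have "\<dots> = (1 - 2 * gap l) * ?m\<^sup>2 + real l / (2 * gap l)"
    using g by (simp add: field_simps)
  \<comment> \<open>The factor is raised to the square of the decay rate of the mean, at the cost of
    \<open>(gap l)\<^sup>2\<close>.\<close>
  also have "\<dots> \<le> (1 - gap l)\<^sup>2 * ?m\<^sup>2 + real l / (2 * gap l)"
    by (intro add_right_mono mult_right_mono zero_le_power2) (simp add: power2_diff)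
  also have "\<dots> = ((1 - gap l) ^ Suc t * Phi l h)\<^sup>2 + real l / (2 * gap l)"
    by (simp add: power_mult_distrib mult.assoc)
  finally show ?case .
qed

text \<open>All paths are translates of one tent: \<open>s = 1\<close> is the highest tiling,
  \<open>s = -1\<close> the lowest.\<close>

definition peak :: "real \<Rightarrow> nat \<Rightarrow> path_family" where
  "peak s l i x = (if i < l \<and> x \<le> 2 * l then real i + s * (real (min x (2 * l - x)) / 2) else 0)"

lemma peak_in_tilings:
  assumes "s = 1 \<or> s = -1"
  shows "peak s l \<in> tilings l"
proof -
  have "peak s l i (x + 1) = peak s l i x + 1/2 \<or> peak s l i (x + 1) = peak s l i x - 1/2"
    if ix: "i < l" "x < 2 * l" for i x
  proof -
    have "real (min (x + 1) (2 * l - (x + 1))) = real (min x (2 * l - x)) + (if x < l then 1 else -1)"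
      using ix by (auto simp: min_def of_nat_diff)
    then have "peak s l i (x + 1) = peak s l i x + s * (if x < l then 1 else -1) / 2"
      using ix by (simp add: peak_def add_divide_distrib distrib_left)
    then show ?thesis using assms by (cases "x < l") auto
  qed
  moreover have "peak s l i 0 = real i \<and> peak s l i (2 * l) = real i" if "i < l" for i
    using that by (simp add: peak_def)
  ultimately show ?thesis by (auto simp: tilings_def peak_def)
qed

text \<open>The second difference of the profile \<open>min x (2l - x) / 2\<close> is minus the point mass at \<open>l\<close>.\<close>

lemma Phi_peak:
  assumes l: "1 \<le> l"
  shows "Phi l (peak s l) = s * real l / (2 - 2 * cos (pi / (2 * real l)))"
proof -
  let ?w = "\<lambda>x. sin (pi * real x / (2 * real l))"
  let ?L = "2 - 2 * cos (pi / (2 * real l))"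
  define g where "g x = real (min x (2 * l - x)) / 2" for x
  have g: "g x = (if x \<le> l then real x / 2 else real l - real x / 2)" if "x \<le> 2 * l" for x
    using that by (auto simp: g_def min_def of_nat_diff diff_divide_distrib)
  \<comment> \<open>The eigenvalue identity applied to the tent yields its weighted sum without
    evaluating it term by term.\<close>
  have "- ?L * (\<Sum>x\<in>{1..2 * l - 1}. ?w x * g x) =
      (\<Sum>x\<in>{1..2 * l - 1}. ?w x * (g (x - 1) + g (x + 1) - 2 * g x))"
    using l by (intro sum_sin_second_difference[symmetric]) (auto simp: g_def)
  also have "\<dots> = (\<Sum>x\<in>{1..2 * l - 1}. if x = l then - ?w l else 0)"
  proof (rule sum.cong)
    fix x assume "x \<in> {1..2 * l - 1}"
    then obtain y where "x = Suc y" "Suc y < 2 * l" by (cases x) auto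
    then have "g (x - 1) + g (x + 1) - 2 * g x = (if x = l then - 1 else 0)"
      by (cases "Suc y < l"; cases "Suc y = l") (simp_all add: g field_simps)
    then show "?w x * (g (x - 1) + g (x + 1) - 2 * g x) = (if x = l then - ?w l else 0)" by simp
  qed simp
  also have "\<dots> = - ?w l" using l by simp
  also have "?w l = 1" using l by simp
  finally have "?L * (\<Sum>x\<in>{1..2 * l - 1}. ?w x * g x) = 1" by linarith
  moreover have "?L \<noteq> 0" using cos_half_angle_less_1[OF l] by simp
  ultimately have "(\<Sum>x\<in>{1..2 * l - 1}. ?w x * g x) = 1 / ?L" by (simp add: field_simps)
  moreover have "Phi l (peak s l) = (\<Sum>x\<in>{1..2 * l - 1}. s * real l * (?w x * g x))"
    unfolding Phi_def
  proof (rule sum.cong)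
    fix x assume "x \<in> {1..2 * l - 1}"
    then have "(\<Sum>j<l. peak s l j x - real j) = (\<Sum>j<l. s * g x)"
      by (intro sum.cong) (auto simp: peak_def g_def)
    then show "?w x * (\<Sum>j<l. peak s l j x - real j) = s * real l * (?w x * g x)" by simp
  qed simp
  ultimately show ?thesis by (simp flip: sum_distrib_left)
qed

section \<open>From moments to the worst-case distance\<close>

lemma tv_le_dbar:
  assumes "g \<in> tilings l" "h \<in> tilings l"
  shows "tv_dist (lrs_law l g t) (lrs_law l h t) \<le> dbar l t"
proof -
  have "{tv_dist (lrs_law l g t) (lrs_law l h t) | g h. g \<in> tilings l \<and> h \<in> tilings l} =
      (\<lambda>(g, h). tv_dist (lrs_law l g t) (lrs_law l h t)) ` (tilings l \<times> tilings l)"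
    by auto
  then show ?thesis
    unfolding dbar_def using assms by (intro Max_ge) (auto simp: finite_tilings)
qed

lemma dbar_le:
  assumes "\<And>g h. g \<in> tilings l \<Longrightarrow> h \<in> tilings l \<Longrightarrow> tv_dist (lrs_law l g t) (lrs_law l h t) \<le> B"
  shows "dbar l t \<le> B"
proof -
  have "{tv_dist (lrs_law l g t) (lrs_law l h t) | g h. g \<in> tilings l \<and> h \<in> tilings l} =
      (\<lambda>(g, h). tv_dist (lrs_law l g t) (lrs_law l h t)) ` (tilings l \<times> tilings l)"
    by auto
  moreover have "tilings l \<noteq> {}" using peak_in_tilings[of 1 l] by blast
  ultimately show ?thesis
    unfolding dbar_def using assms by (subst Max_le_iff) (auto simp: finite_tilings)
qed

text \<open>The premise says that the variance bound is at most the squared mean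
  \<open>m\<^sup>2\<close>. Both second moments are then at most \<open>2 * m\<^sup>2\<close> while
  the means are \<open>m\<close> and \<open>-m\<close>, so \<open>(2 * m)\<^sup>2\<close> is at most
  \<open>8 * m\<^sup>2\<close> times the distance.\<close>

lemma dbar_ge_half:
  assumes l: "2 \<le> l"
    and t: "real l / (2 * gap l) \<le> ((1 - gap l) ^ t * (real l / (2 - 2 * cos (pi / (2 * real l)))))\<^sup>2"
  shows "1/2 \<le> dbar l t"
proof -
  have l1: "1 \<le> l" using l by simp
  define m where "m = (1 - gap l) ^ t * (real l / (2 - 2 * cos (pi / (2 * real l))))"
  let ?p = "lrs_law l (peak 1 l) t" and ?q = "lrs_law l (peak (-1) l) t"
  have P: "peak 1 l \<in> tilings l" "peak (-1) l \<in> tilings l" by (auto intro: peak_in_tilings)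
  have "0 < m"
    unfolding m_def using l gap_le_half[OF l] cos_half_angle_less_1[OF l1]
    by (intro mult_pos_pos zero_less_power) auto
  have M: "(1 - gap l) ^ t * Phi l (peak 1 l) = m" "(1 - gap l) ^ t * Phi l (peak (-1) l) = - m"
    unfolding Phi_peak[OF l1] m_def by auto
  have E: "measure_pmf.expectation ?p (Phi l) = m" "measure_pmf.expectation ?q (Phi l) = - m"
    using expectation_Phi_law[OF l1] P M by auto
  have V: "measure_pmf.expectation ?p (\<lambda>g. (Phi l g)\<^sup>2) \<le> 2 * m\<^sup>2"
    "measure_pmf.expectation ?q (\<lambda>g. (Phi l g)\<^sup>2) \<le> 2 * m\<^sup>2"
    using expectation_Phi_sq_law[OF l P(1), of t] expectation_Phi_sq_law[OF l P(2), of t]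
      t[folded m_def] unfolding M by auto
  have fin: "finite (tilings l)" "set_pmf ?p \<subseteq> tilings l" "set_pmf ?q \<subseteq> tilings l"
    using finite_tilings set_lrs_law[OF l1] P by auto
  have tv0: "0 \<le> tv_dist ?p ?q"
    unfolding tv_dist_finite[OF fin] by (simp add: sum_nonneg)
  have "(2 * m)\<^sup>2 \<le> 2 * tv_dist ?p ?q * (measure_pmf.expectation ?p (\<lambda>g. (Phi l g)\<^sup>2) +
      measure_pmf.expectation ?q (\<lambda>g. (Phi l g)\<^sup>2))"
    using tv_dist_ge_moments[OF fin, of "Phi l"] unfolding E by simp
  also have "\<dots> \<le> 2 * tv_dist ?p ?q * (4 * m\<^sup>2)"
    using V tv0 by (intro mult_left_mono) auto
  finally have "4 * m\<^sup>2 \<le> (8 * tv_dist ?p ?q) * m\<^sup>2" by (simp add: power2_eq_square mult_ac)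
  then have "1/2 \<le> tv_dist ?p ?q" using \<open>0 < m\<close> by simp
  then show ?thesis using tv_le_dbar[OF P, of t] by simp
qed

section \<open>Convergence of the chain\<close>

text \<open>Without a local minimum a path that has once gone down never rises again, so every path
  goes up and then down.\<close>

lemma no_local_min_imp_peak:
  assumes h: "h \<in> tilings l"
    and no_min: "\<And>i x. i < l \<Longrightarrow> 0 < x \<Longrightarrow> x < 2 * l \<Longrightarrow> \<not> loc_ext 1 h i x"
  shows "h = peak 1 l"
proof -
  have "h i x = real i + real (min x (2 * l - x)) / 2" if i: "i < l" and x: "x \<le> 2 * l" for i x
  proof -
    have L: "h i x = real i + real x / 2 \<or> 0 < x \<and> h i (x - 1) = h i x + 1/2" using x
    proof (induction x)
      case 0
      then show ?case using tilings_start[OF h i] by simp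
    next
      case (Suc x)
      then show ?case
        using tilings_step[OF h i, of x] no_min[OF i, of x]
        by (auto simp: loc_ext_def field_simps)
    qed
    have R: "h i x = real i + real (2 * l - x) / 2 \<or> x < 2 * l \<and> h i (x + 1) = h i x + 1/2" using x
    proof (induction x rule: inc_induct)
      case base
      then show ?case using tilings_end[OF h i] by simp
    next
      case (step x)
      then show ?case
        using tilings_step[OF h i, of x] no_min[OF i, of "Suc x"]
        by (auto simp: loc_ext_def of_nat_diff field_simps)
    qed
    \<comment> \<open>If both first alternatives failed, a down-step into \<open>x\<close> followed
      by an up-step would be a local minimum. The bounds then select the smaller value.\<close>
    have "h i x = real i + real x / 2 \<or> h i x = real i + real (2 * l - x) / 2"
      using L R no_min[OF i, of x] unfolding loc_ext_def by blast
    then show ?thesis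
      using tilings_bounds[OF h i x] by (auto simp: min_def)
  qed
  then show ?thesis
    using tilings_outside[OF h] by (intro ext) (auto simp: peak_def)
qed

section \<open>Reachability of the highest tiling and contraction\<close>

lemma lrs_law_add:
  "lrs_law l h (s + t) = bind_pmf (lrs_law l h s) (\<lambda>z. lrs_law l z t)"
  by (induction t) (simp_all add: bind_return_pmf' bind_assoc_pmf)

lemma lrs_step_lazy:
  assumes "1 \<le> l"
  shows "h \<in> set_pmf (lrs_step l h)"
proof -
  obtain p where "p \<in> internal_points l" using internal_points_nonempty[OF assms] by blast
  \<comment> \<open>A point cannot be a local minimum and a local maximum at once, so one of the two
    directions leaves \<open>h\<close> unchanged.\<close>
  moreover have "\<exists>s\<in>{1, -1}. h \<in> set_pmf (attempt l h s (fst p) (snd p))"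
    by (auto simp: attempt_def loc_ext_def)
  ultimately show ?thesis unfolding set_lrs_step[OF assms] by blast
qed

lemma push_in_set_lrs_step:
  assumes "1 \<le> l" "s = 1 \<or> s = -1" "i < l" "0 < x" "x < 2 * l" "loc_ext s h i x"
  shows "push s l h i x \<in> set_pmf (lrs_step l h)"
proof -
  have "(i, x) \<in> internal_points l" using assms by (auto simp: internal_points_def)
  moreover have "True \<in> set_pmf (bernoulli_pmf (1 / (real (blockers s l h i x) + 1)))"
    by (simp add: set_pmf_iff)
  then have "push s l h i x \<in> set_pmf (attempt l h s i x)"
    using assms(6) unfolding attempt_def by force
  ultimately show ?thesis
    unfolding set_lrs_step[OF assms(1)] using assms(2) by force
qed

lemma lrs_law_reach_mono:
  assumes "1 \<le> l" "g \<in> set_pmf (lrs_law l h s)" "s \<le> t"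
  shows "g \<in> set_pmf (lrs_law l h t)"
  using assms(3)
proof (induction t rule: dec_induct)
  case (step t)
  then show ?case using lrs_step_lazy[OF assms(1), of g] by auto
qed (use assms in auto)

text \<open>Every tiling other than the highest one can be pushed up, which increases its volume.\<close>

lemma lrs_law_reaches_peak:
  assumes l: "1 \<le> l" and "h \<in> tilings l"
  shows "\<exists>t. peak 1 l \<in> set_pmf (lrs_law l h t)"
proof -
  define W where "W g = (\<Sum>y\<in>{1..2 * l - 1}. 1 * (\<Sum>j<l. g j y - real j))" for g :: path_family
  show ?thesis using assms(2)
  \<comment> \<open>The induction measure counts the tilings of larger volume; it drops because the
    pushed tiling is counted for \<open>h\<close> but not for itself.\<close>
  proof (induction "card {g \<in> tilings l. W h < W g}" arbitrary: h rule: less_induct)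
    case less
    show ?case
    proof (cases "h = peak 1 l")
      case True
      then have "peak 1 l \<in> set_pmf (lrs_law l h 0)" by simp
      then show ?thesis by blast
    next
      case False
      then obtain i x where ix: "i < l" "0 < x" "x < 2 * l" "loc_ext 1 h i x"
        using no_local_min_imp_peak[OF less.prems] by blast
      let ?g = "push 1 l h i x"
      have g: "?g \<in> tilings l" by (rule push_in_tilings) (use less.prems ix in auto)
      have "W ?g = W h + 1 * 1 * (real (blockers 1 l h i x) + 1)"
        unfolding W_def by (rule sum_push) (use less.prems ix in auto)
      then have "W h < W ?g" by simp
      then have "{g' \<in> tilings l. W ?g < W g'} \<subset> {g' \<in> tilings l. W h < W g'}" using g by force
      then have "card {g' \<in> tilings l. W ?g < W g'} < card {g' \<in> tilings l. W h < W g'}"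
        by (rule psubset_card_mono[rotated]) (simp add: finite_tilings)
      from less.hyps[OF this g] obtain t where t: "peak 1 l \<in> set_pmf (lrs_law l ?g t)" by blast
      have "?g \<in> set_pmf (lrs_law l h 1)"
        using push_in_set_lrs_step[OF l _ ix] by (simp add: bind_return_pmf)
      then have "peak 1 l \<in> set_pmf (lrs_law l h (1 + t))"
        unfolding lrs_law_add set_bind_pmf using t by blast
      then show ?thesis by blast
    qed
  qed
qed

lemma lrs_mixes:
  assumes l: "1 \<le> l" and "0 < c"
  shows "\<exists>t. dbar l t < c"
proof -
  have P: "peak 1 l \<in> tilings l" by (rule peak_in_tilings) simp
  obtain T where T: "\<And>h. h \<in> tilings l \<Longrightarrow> peak 1 l \<in> set_pmf (lrs_law l h (T h))"
    using lrs_law_reaches_peak[OF l] by metis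
  \<comment> \<open>Since the chain may stay put, one time \<open>N\<close> serves all starting
    tilings; \<delta> below is the least probability of being at the top then. Each block of
    \<open>N\<close> steps contracts the distance by \<open>1 - \<delta>\<close>.\<close>
  define N where "N = Max (T ` tilings l)"
  have N: "peak 1 l \<in> set_pmf (lrs_law l h N)" if "h \<in> tilings l" for h
    using that finite_tilings lrs_law_reach_mono[OF l T[OF that]] by (auto simp: N_def)
  define \<delta> where "\<delta> = Min ((\<lambda>h. pmf (lrs_law l h N) (peak 1 l)) ` tilings l)"
  have \<delta>: "\<delta> \<le> pmf (lrs_law l h N) (peak 1 l)" if "h \<in> tilings l" for h
    unfolding \<delta>_def using that finite_tilings by (intro Min_le) auto
  have "0 < \<delta>"
    unfolding \<delta>_def using P finite_tilings N by (subst Min_gr_iff) (auto simp: pmf_positive_iff)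
  have "\<delta> \<le> 1" using \<delta>[OF P] pmf_le_1 by (rule order_trans)
  have tv: "tv_dist (lrs_law l g (k * N)) (lrs_law l h (k * N)) \<le> (1 - \<delta>) ^ k"
    if gh: "g \<in> tilings l" "h \<in> tilings l" for g h k
  proof (induction k)
    case 0
    show ?case
      using tv_dist_le_1[OF finite_tilings set_lrs_law[OF l gh(1)] set_lrs_law[OF l gh(2)], of 0 0]
      by simp
  next
    case (Suc k)
    have "tv_dist (lrs_law l g (k * N + N)) (lrs_law l h (k * N + N)) \<le>
        (1 - \<delta>) * tv_dist (lrs_law l g (k * N)) (lrs_law l h (k * N))"
      unfolding lrs_law_add
      using set_lrs_law[OF l] gh P \<delta>
      by (intro tv_dist_bind_le[where A = "tilings l" and c = "peak 1 l"]) (auto simp: finite_tilings)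
    also have "\<dots> \<le> (1 - \<delta>) * (1 - \<delta>) ^ k"
      using Suc \<open>\<delta> \<le> 1\<close> by (intro mult_left_mono) auto
    finally show ?case by (simp add: add.commute)
  qed
  obtain k where "(1 - \<delta>) ^ k < c"
    using real_arch_pow_inv[OF \<open>0 < c\<close>, of "1 - \<delta>"] \<open>0 < \<delta>\<close> by auto
  then show ?thesis using dbar_le[of l "k * N", OF tv] by (meson le_less_trans)
qed

lemma dbar_mixing_time: "1 \<le> l \<Longrightarrow> dbar l (mixing_time l) < 1 / exp 1"
  unfolding mixing_time_def by (rule LeastI_ex) (use lrs_mixes[of l "1 / exp 1"] in auto)

section \<open>The lower bound\<close>

text \<open>Before this time \<open>(1 - gap l) ^ (2 * t)\<close> is at least \<open>8 / l\<close>,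
  by \<open>- ln (1 - g) \<le> g / (1 - g)\<close>. The value \<open>8 / l\<close> is what the
  moment comparison asks for.\<close>

definition mixing_bound :: "nat \<Rightarrow> real" where
  "mixing_bound l = (1 - gap l) / (2 * gap l) * (ln (real l) - ln 8)"

text \<open>The contradiction is drawn at \<open>t = mixing_time l\<close> itself, where the
  distance is below \<open>1 / e\<close> by definition but at least \<open>1/2\<close> by the moment
  bound.\<close>

lemma mixing_time_ge:
  assumes l: "2 \<le> l"
  shows "mixing_bound l \<le> real (mixing_time l)"
proof (rule ccontr)
  define t where "t = mixing_time l"
  assume "\<not> mixing_bound l \<le> real (mixing_time l)"
  then have t: "real t < mixing_bound l" by (simp add: t_def)
  have l1: "1 \<le> l" using l by simp
  define L where "L = 2 - 2 * cos (pi / (2 * real l))"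
  have L: "0 < L" using cos_half_angle_less_1[OF l1] by (simp add: L_def)
  have g: "0 < gap l" "gap l \<le> 1/2" using gap_pos[OF l1] gap_le_half[OF l] by auto
  have gapL: "gap l = L / (2 * (real l * (2 * real l - 1)))"
    unfolding gap_def L_def using l by (simp add: divide_simps) (simp add: algebra_simps)
  have L_le: "L \<le> 8 / (2 * (real l)\<^sup>2)"
  proof -
    have "L \<le> (pi / (2 * real l))\<^sup>2"
    proof -
      let ?x = "pi / (2 * real l)"
      have "L = (2 * sin (?x / 2))\<^sup>2"
        using cos_double_sin[of "?x / 2"] by (simp add: L_def power2_eq_square)
      also have "\<dots> \<le> ?x\<^sup>2"
        using abs_sin_x_le_abs_x[of "?x / 2"] unfolding abs_le_square_iff[symmetric] by simp
      finally show ?thesis .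
    qed
    also have "\<dots> = (pi\<^sup>2 / 2) / (2 * (real l)\<^sup>2)" by (simp add: power2_eq_square)
    \<comment> \<open>The crude bound \<open>pi < 4\<close> is enough: a constant factor here only
      shifts \<open>ln l\<close> by a constant.\<close>
    also have "pi\<^sup>2 / 2 \<le> 8"
      using power_mono[of pi 4 2] pi_less_4 by simp
    then have "(pi\<^sup>2 / 2) / (2 * (real l)\<^sup>2) \<le> 8 / (2 * (real l)\<^sup>2)"
      by (rule divide_right_mono) simp
    finally show ?thesis .
  qed
  have "- ln (1 - gap l) \<le> gap l / (1 - gap l)"
    using ln_diff_le[of 1 "1 - gap l"] g by simp
  then have "2 * real t * - ln (1 - gap l) \<le> 2 * real t * (gap l / (1 - gap l))"
    by (intro mult_left_mono) auto
  also have "\<dots> \<le> 2 * mixing_bound l * (gap l / (1 - gap l))"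
    using t g by (intro mult_right_mono) auto
  also have "\<dots> = ln (real l / 8)"
    using g l by (simp add: mixing_bound_def ln_div)
  finally have "ln (8 / real l) \<le> ln ((1 - gap l) ^ (2 * t))"
    using g l by (simp add: ln_div ln_realpow)
  then have P: "8 / real l \<le> (1 - gap l) ^ (2 * t)"
    using g l by (subst (asm) ln_le_cancel_iff) auto
  \<comment> \<open>In terms of \<open>L\<close> the premise of \<open>dbar_ge_half\<close> follows
    from \<open>2 * l * L \<le> (1 - gap l) ^ (2 * t)\<close>, whose left side is at most
    \<open>8 / l\<close>.\<close>
  have "real l / (2 * gap l) = (real l)\<^sup>2 * (2 * real l - 1) / L"
    using g L l by (simp add: gapL power2_eq_square field_simps)
  also have "\<dots> \<le> (real l)\<^sup>2 * (2 * real l) / L"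
    using L by (intro divide_right_mono mult_left_mono) auto
  also have "\<dots> = (2 * real l * L) * ((real l)\<^sup>2 / L\<^sup>2)"
    using L by (simp add: power2_eq_square)
  also have "\<dots> \<le> (1 - gap l) ^ (2 * t) * ((real l)\<^sup>2 / L\<^sup>2)"
  proof (rule mult_right_mono)
    have "2 * real l * L \<le> 2 * real l * (8 / (2 * (real l)\<^sup>2))"
      using L_le by (intro mult_left_mono) auto
    also have "\<dots> = 8 / real l" by (simp add: power2_eq_square)
    finally show "2 * real l * L \<le> (1 - gap l) ^ (2 * t)" using P by linarith
  qed simp
  also have "\<dots> = ((1 - gap l) ^ t * (real l / L))\<^sup>2"
    by (simp add: power_mult_distrib power_divide power_mult[symmetric] mult.commute)
  finally have "1/2 \<le> dbar l t"
    unfolding L_def by (rule dbar_ge_half[OF l])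
  moreover have "dbar l t < 1 / exp 1" unfolding t_def by (rule dbar_mixing_time[OF l1])
  moreover have "1 / exp 1 \<le> (1/2 :: real)" using exp_ge_add_one_self[of 1] by (simp add: divide_le_eq)
  ultimately show False by linarith
qed

text \<open>Here \<open>1 - cos (pi / (2 * l))\<close> behaves like
  \<open>pi\<^sup>2 / (8 * l\<^sup>2)\<close> and is divided by about \<open>2 * l\<^sup>2\<close>,
  so \<open>gap l * l ^ 4\<close> tends to \<open>pi\<^sup>2 / 16\<close>; the term
  \<open>ln 8\<close> is absorbed by \<open>ln l\<close>.\<close>

lemma mixing_bound_asymp:
  "(\<lambda>l. 8 / pi\<^sup>2 - mixing_bound l / (real l ^ 4 * ln (real l))) \<in> o(\<lambda>_. 1)"
proof -
  have "(\<lambda>l. (1 - gap l) / (2 * (gap l * real l ^ 4)) * ((ln (real l) - ln 8) / ln (real l)))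
      \<longlonglongrightarrow> (1 - 0) / (2 * (pi\<^sup>2 / 16)) * 1"
  proof (intro tendsto_mult tendsto_divide tendsto_diff tendsto_const)
    show "gap \<longlonglongrightarrow> 0" unfolding gap_def by real_asymp
    show "(\<lambda>l. gap l * real l ^ 4) \<longlonglongrightarrow> pi\<^sup>2 / 16"
      unfolding gap_def by (real_asymp simp: power2_eq_square)
    show "(\<lambda>l. (ln (real l) - ln 8) / ln (real l)) \<longlonglongrightarrow> 1" by real_asymp
  qed simp
  then have "(\<lambda>l. 8 / pi\<^sup>2 - mixing_bound l / (real l ^ 4 * ln (real l))) \<longlonglongrightarrow> 8 / pi\<^sup>2 - 8 / pi\<^sup>2"
    unfolding mixing_bound_def by (intro tendsto_diff tendsto_const) (simp add: mult_ac)
  then show ?thesis by (simp add: smalloI_tendsto)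
qed

theorem theorem8:
  "\<exists>\<epsilon> :: nat \<Rightarrow> real. \<epsilon> \<in> o(\<lambda>_. 1) \<and>
     (\<forall>l\<ge>1. real (mixing_time l) \<ge> (8 / pi\<^sup>2 - \<epsilon> l) * real l ^ 4 * ln (real l))"
proof (intro exI conjI allI impI)
  show "(\<lambda>l. 8 / pi\<^sup>2 - mixing_bound l / (real l ^ 4 * ln (real l))) \<in> o(\<lambda>_. 1)"
    by (rule mixing_bound_asymp)
  fix l :: nat assume "1 \<le> l"
  \<comment> \<open>The error term is chosen so that the right side collapses to
    \<open>mixing_bound l\<close> for \<open>2 \<le> l\<close>; for \<open>l = 1\<close> it is 0
    because \<open>ln 1 = 0\<close>.\<close>
  then consider "l = 1" | "2 \<le> l" by linarith
  then show "(8 / pi\<^sup>2 - (8 / pi\<^sup>2 - mixing_bound l / (real l ^ 4 * ln (real l)))) * real l ^ 4 * ln (real l)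
      \<le> real (mixing_time l)"
  proof cases
    case 2
    then show ?thesis using mixing_time_ge[OF 2] by simp
  qed simp
qed

end
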